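(* For every positive integer $n$ and every $c\in\{1,\ldots,n\}$, $$\rho(I(n,c))=\frac{c(n-c+2)}{n+1}.$$
   Context: Let $\mathbb{K}$ be an arbitrary field and $S(n)=\mathbb{K}[x_0,\ldots,x_n]$. Let $H_i=\{x_i=0\}\subset\mathbb{P}^n$ for $i=0,\ldots,n$. For $c\in\{1,\ldots,n\}$, $I(n,c)\subset S(n)$ denotes the ideal of the union (with reduced structure) of all $c$-fold intersections $H_{i_1}\cap\cdots\cap H_{i_c}$ with $i_1,\ldots,i_c\in\{0,\ldots,n\}$ pairwise distinct; that is, $I(n,c)$ is the intersection of the prime ideals $\langle x_{i_1},\ldots,x_{i_c}\rangle$ over all such choices of indices. For a homogeneous ideal $I\subseteq S(n)$ and a positive integer $m$, the $m$-th symbolic power is $I^{(m)}=S(n)\cap\bigcap_{Q\in\mathrm{Ass}(I)}I^m_Q$, where $I^m_Q$ is the localization of $I^m$ at $Q$ and the intersection takes place in the field of fractions of $S(n)$. For a non-trivial (i.e. $I\neq\langle 0\rangle$ and $I\neq\langle 1\rangle$) homogeneous ideal $I\subseteq S(n)$, the resurgence of $I$ is the real number $$\rho(I)=\sup\left\{\frac{m}{r}:\ I^{(m)}\nsubseteq I^{r}\right\},$$ where $m,r$ range over positive integers and $I^r$ is the ordinary power. *)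

theory Defs
  imports
    "HOL-Algebra.Ideal_Product"
    "HOL-Algebra.Algebraic_Closure_Type"
    "HOL-Library.Poly_Mapping"
    "HOL-Computational_Algebra.Fraction_Field"
    "HOL-Library.Extended_Real"
begin

text \<open>
  Polynomials are finitely supported functions from monomials (exponent vectors
  \<^typ>\<open>nat \<Rightarrow>\<^sub>0 nat\<close>) to coefficients, with the convolution product of
  \<^theory>\<open>HOL-Library.Poly_Mapping\<close>. This type has the infinitely many variables
  \<open>x\<^sub>0, x\<^sub>1, \<dots>\<close>; the ring \<open>S(n) = K[x\<^sub>0, \<dots>, x\<^sub>n]\<close> is the subring of polynomials in
  which only the first \<open>n + 1\<close> of them occur. Ideals, primes and powers are all
  taken in \<open>S(n)\<close>.
\<close>

type_synonym 'k mpoly = "(nat \<Rightarrow>\<^sub>0 nat) \<Rightarrow>\<^sub>0 'k"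

definition var :: "nat \<Rightarrow> 'k::field mpoly" where
  "var i = Poly_Mapping.single (Poly_Mapping.single i 1) 1"

definition poly_ring :: "nat \<Rightarrow> 'k::field mpoly ring" where
  "poly_ring n = ring_of_type_algebra
     \<lparr>carrier := {p. \<forall>m \<in> Poly_Mapping.keys p. Poly_Mapping.keys m \<subseteq> {0..n}}\<rparr>"

definition star_ideal :: "nat \<Rightarrow> nat \<Rightarrow> 'k::field mpoly set" where
  "star_ideal n c =
     (\<Inter>A \<in> {A. A \<subseteq> {0..n} \<and> card A = c}. Idl\<^bsub>poly_ring n\<^esub> (var ` A))"

definition ideal_power :: "('a, 'b) ring_scheme \<Rightarrow> 'a set \<Rightarrow> nat \<Rightarrow> 'a set" where
  "ideal_power R I r = I [^]\<^bsub>ideals_set R\<^esub> r"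

text \<open>
  \<open>Ass(I)\<close> means \<open>Ass(R/I)\<close>: the primes that are annihilators of elements of the
  \<open>R\<close>-module \<open>R/I\<close>. The annihilator of the class of \<open>f\<close> is \<open>(I : f)\<close>.
\<close>

definition associated_primes :: "('a, 'b) ring_scheme \<Rightarrow> 'a set \<Rightarrow> 'a set set" where
  "associated_primes R I =
     {Q. primeideal Q R \<and> (\<exists>f \<in> carrier R. Q = {g \<in> carrier R. g \<otimes>\<^bsub>R\<^esub> f \<in> I})}"

text \<open>
  The field of fractions of \<open>S(n)\<close> is a subfield of \<^typ>\<open>'k::field mpoly fract\<close>; all
  numerators and denominators below lie in \<open>S(n)\<close>.
\<close>

definition localized_ideal ::
  "nat \<Rightarrow> 'k::field mpoly set \<Rightarrow> 'k mpoly set \<Rightarrow> 'k mpoly fract set" where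
  "localized_ideal n J Q = {Fract a s | a s. a \<in> J \<and> s \<in> carrier (poly_ring n) - Q}"

definition symbolic_power :: "nat \<Rightarrow> 'k::field mpoly set \<Rightarrow> nat \<Rightarrow> 'k mpoly set" where
  "symbolic_power n I m =
     {f \<in> carrier (poly_ring n).
        Fract f 1 \<in> (\<Inter>Q \<in> associated_primes (poly_ring n) I.
                        localized_ideal n (ideal_power (poly_ring n) I m) Q)}"

text \<open>
  The supremum is taken in the extended reals, so that an equation
  \<open>resurgence n I = ereal x\<close> includes the assertion that the set of quotients is
  nonempty and bounded above.
\<close>

definition resurgence :: "nat \<Rightarrow> 'k::field mpoly set \<Rightarrow> ereal" where
  "resurgence n I =
     Sup {ereal (real m / real r) | m r.
            m > 0 \<and> r > 0 \<and> \<not> symbolic_power n I m \<subseteq> ideal_power (poly_ring n) I r}"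

lemma poly_ring_sel [simp]:
  "monoid.mult (poly_ring n) = (*)" "ring.add (poly_ring n) = (+)"
  "monoid.one (poly_ring n) = 1" "ring.zero (poly_ring n) = 0"
  by (simp_all add: poly_ring_def ring_of_type_algebra_def)

lemma in_carrier_poly_ring:
  "p \<in> carrier (poly_ring n) \<longleftrightarrow>
     (\<forall>m \<in> Poly_Mapping.keys p. Poly_Mapping.keys m \<subseteq> {0..n})"
  by (simp add: poly_ring_def)

lemma var_in_carrier: "i \<le> n \<Longrightarrow> var i \<in> carrier (poly_ring n)"
  by (simp add: in_carrier_poly_ring var_def)

lemma domain_poly_ring: "domain (poly_ring n :: 'k::field mpoly ring)"
proof -
  let ?S = "poly_ring n :: 'k mpoly ring"
  have add: "p + q \<in> carrier ?S" if "p \<in> carrier ?S" "q \<in> carrier ?S" for p q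
    using that Poly_Mapping.keys_add[of p q] unfolding in_carrier_poly_ring by blast
  have mult: "p * q \<in> carrier ?S" if "p \<in> carrier ?S" "q \<in> carrier ?S" for p q
    unfolding in_carrier_poly_ring
  proof
    fix m assume "m \<in> Poly_Mapping.keys (p * q)"
    then obtain a b where "m = a + b" "a \<in> Poly_Mapping.keys p" "b \<in> Poly_Mapping.keys q"
      using Poly_Mapping.keys_mult[of p q] by blast
    then show "Poly_Mapping.keys m \<subseteq> {0..n}"
      using that Poly_Mapping.keys_add[of a b] unfolding in_carrier_poly_ring by blast
  qed
  have neg: "- p \<in> carrier ?S" if "p \<in> carrier ?S" for p
    using that by (simp add: in_carrier_poly_ring)
  have zero_one: "0 \<in> carrier ?S" "1 \<in> carrier ?S"
    by (simp_all add: in_carrier_poly_ring)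
  have "cring ?S"
  proof (rule cringI)
    show "abelian_group ?S"
    proof (rule abelian_groupI)
      fix p assume "p \<in> carrier ?S"
      then show "\<exists>q \<in> carrier ?S. q \<oplus>\<^bsub>?S\<^esub> p = \<zero>\<^bsub>?S\<^esub>"
        using neg by (intro bexI[of _ "- p"]) auto
    qed (auto simp: add zero_one algebra_simps)
    show "comm_monoid ?S"
      by unfold_locales (auto simp: mult zero_one algebra_simps)
  qed (auto simp: algebra_simps)
  then show ?thesis
    by (rule domain.intro) (unfold_locales, auto)
qed

end

theory Submission
  imports Defs
begin

text \<open>
  Put \<open>N = n + 1\<close> and \<open>d = n - c + 2\<close>. The ideal \<open>I = I(n,c)\<close> is spanned by the monomials with at
  least \<open>d\<close> variables in their support. Weighing monomials by their degree in the variables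
  \<open>x\<^sub>i\<close>, \<open>i \<in> A\<close>, with \<open>|A| = c\<close>, shows that the exponents of \<open>I\<^bsup>(m)\<^esup>\<close> satisfy
  \<open>(\<Sum>i\<in>A. a i) \<ge> m\<close>, while \<open>I\<^bsup>r\<^esup>\<close> contains the monomials with
  \<open>(\<Sum>i\<le>n. min (a i) r) \<ge> r d\<close>. Averaging over the exponents below \<open>r\<close> gives containment as soon as
  \<open>m N \<ge> c d r\<close>. Conversely the monomial with all exponents \<open>t\<close> lies in \<open>I\<^bsup>(c t)\<^esup>\<close> but, for degree
  reasons, not in \<open>I\<^bsup>r\<^esup>\<close> when \<open>N t < r d\<close>; with \<open>t = d s\<close> and \<open>r = N s + 1\<close> the quotients \<open>c t / r\<close>
  tend to \<open>c d / N\<close>.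
\<close>

section \<open>Weights of monomials\<close>

text \<open>For finite \<open>A\<close> the least weight over \<open>Poly_Mapping.keys f\<close> is
  the order of vanishing of a non-zero \<open>f\<close> along the subspace where all
  \<open>x_i\<close> with \<open>i\<close> in \<open>A\<close> vanish.\<close>

definition weight :: "nat set \<Rightarrow> (nat \<Rightarrow>\<^sub>0 nat) \<Rightarrow> nat" where
  "weight A k = (\<Sum>i\<in>A. Poly_Mapping.lookup k i)"

lemma weight_add: "weight A (k + l) = weight A k + weight A l"
  by (simp add: weight_def lookup_add sum.distrib)

text \<open>Rephrases membership in the prime of \<open>A\<close> by weights, whose additivity then
  yields both closure under multiplication and primality.\<close>

lemma weight_pos_iff:
  assumes "finite A"
  shows "weight A k > 0 \<longleftrightarrow> Poly_Mapping.keys k \<inter> A \<noteq> {}"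
  using assms by (auto simp: weight_def in_keys_iff simp flip: neq0_conv)

lemma poly_mapping_expand:
  "f = (\<Sum>k\<in>Poly_Mapping.keys f. Poly_Mapping.single k (Poly_Mapping.lookup f k))"
  by (rule poly_mapping_eqI)
     (auto simp: lookup_sum lookup_single when_def in_keys_iff)

definition restrict_keys :: "('a \<Rightarrow> bool) \<Rightarrow> ('a \<Rightarrow>\<^sub>0 'b::comm_monoid_add) \<Rightarrow> 'a \<Rightarrow>\<^sub>0 'b" where
  "restrict_keys P f =
     (\<Sum>k\<in>{k \<in> Poly_Mapping.keys f. P k}. Poly_Mapping.single k (Poly_Mapping.lookup f k))"

lemma lookup_restrict_keys:
  "Poly_Mapping.lookup (restrict_keys P f) k = (if P k then Poly_Mapping.lookup f k else 0)"
  unfolding restrict_keys_def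
  by (auto simp: lookup_sum lookup_single when_def in_keys_iff)

lemma keys_restrict_keys:
  "Poly_Mapping.keys (restrict_keys P f) = {k \<in> Poly_Mapping.keys f. P k}"
  by (auto simp: in_keys_iff lookup_restrict_keys split: if_splits)

text \<open>The initial forms of \<open>f\<close> and \<open>g\<close> with respect to the weight have a non-zero product.\<close>

lemma keys_mult_min_weight:
  fixes f g :: "'k::field mpoly"
  assumes "f \<noteq> 0" "g \<noteq> 0"
  obtains u k l where "u \<in> Poly_Mapping.keys (f * g)" "k \<in> Poly_Mapping.keys f"
    "l \<in> Poly_Mapping.keys g" "weight A u = weight A k + weight A l"
    "\<And>k'. k' \<in> Poly_Mapping.keys f \<Longrightarrow> weight A k \<le> weight A k'"
    "\<And>l'. l' \<in> Poly_Mapping.keys g \<Longrightarrow> weight A l \<le> weight A l'"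
proof -
  have "\<exists>k. k \<in> Poly_Mapping.keys h \<and> (\<forall>k'. k' \<in> Poly_Mapping.keys h \<longrightarrow> weight A k \<le> weight A k')"
    if "h \<noteq> 0" for h :: "'k mpoly"
    using that ex_has_least_nat[of "\<lambda>k. k \<in> Poly_Mapping.keys h" _ "weight A"]
    by (metis all_not_in_conv keys_eq_empty)
  then obtain k l where
    k: "k \<in> Poly_Mapping.keys f" "\<And>k'. k' \<in> Poly_Mapping.keys f \<Longrightarrow> weight A k \<le> weight A k'" and
    l: "l \<in> Poly_Mapping.keys g" "\<And>l'. l' \<in> Poly_Mapping.keys g \<Longrightarrow> weight A l \<le> weight A l'"
    using assms by meson
  define f0 where "f0 = restrict_keys (\<lambda>v. weight A v = weight A k) f"
  define f1 where "f1 = restrict_keys (\<lambda>v. weight A v \<noteq> weight A k) f"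
  define g0 where "g0 = restrict_keys (\<lambda>v. weight A v = weight A l) g"
  define g1 where "g1 = restrict_keys (\<lambda>v. weight A v \<noteq> weight A l) g"
  have f: "f = f0 + f1" and g: "g = g0 + g1"
    unfolding f0_def f1_def g0_def g1_def
    by (auto intro!: poly_mapping_eqI simp: lookup_add lookup_restrict_keys)
  have "k \<in> Poly_Mapping.keys f0" "l \<in> Poly_Mapping.keys g0"
    using k l by (auto simp: f0_def g0_def keys_restrict_keys)
  then have "f0 \<noteq> 0" "g0 \<noteq> 0" by auto
  \<comment> \<open>Several pairs of monomials may share the least weight and cancel in part, so
    whole lowest forms are multiplied; absence of zero divisors makes something survive.\<close>
  then have "f0 * g0 \<noteq> 0" by simp
  then obtain u where u: "u \<in> Poly_Mapping.keys (f0 * g0)"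
    by (metis all_not_in_conv keys_eq_empty)
  have wu: "weight A u = weight A k + weight A l"
    using u keys_mult[of f0 g0] by (auto simp: f0_def g0_def keys_restrict_keys weight_add)
  \<comment> \<open>The other products only have monomials of strictly larger weight, so they cannot
    cancel \<open>u\<close>.\<close>
  have "weight A v > weight A k + weight A l" if v: "v \<in> Poly_Mapping.keys (f1 * g)" for v
  proof -
    obtain a b where "v = a + b" "a \<in> Poly_Mapping.keys f1" "b \<in> Poly_Mapping.keys g"
      using subsetD[OF keys_mult v] by blast
    then show ?thesis
      using k(2)[of a] l(2)[of b] by (auto simp: f1_def keys_restrict_keys weight_add)
  qed
  moreover have "weight A v > weight A k + weight A l" if v: "v \<in> Poly_Mapping.keys (f0 * g1)" for v
  proof -
    obtain a b where "v = a + b" "a \<in> Poly_Mapping.keys f0" "b \<in> Poly_Mapping.keys g1"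
      using subsetD[OF keys_mult v] by blast
    then show ?thesis
      using l(2)[of b] by (auto simp: f0_def g1_def keys_restrict_keys weight_add)
  qed
  ultimately have "u \<notin> Poly_Mapping.keys (f1 * g)" "u \<notin> Poly_Mapping.keys (f0 * g1)"
    using wu by fastforce+
  moreover have "f * g = f0 * g0 + (f0 * g1 + f1 * g)"
    unfolding f g by (simp add: algebra_simps)
  ultimately have "u \<in> Poly_Mapping.keys (f * g)"
    using u by (simp add: in_keys_iff lookup_add)
  with k l wu that show thesis by blast
qed

section \<open>Ideals spanned by monomials\<close>

lemma cring_poly_ring: "cring (poly_ring n :: 'k::field mpoly ring)"
  using domain_poly_ring domain.axioms(1) by blast

lemma ring_poly_ring: "ring (poly_ring n :: 'k::field mpoly ring)"
  using cring_poly_ring cring.axioms(1) by blast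

lemma poly_ring_idealI:
  fixes J :: "'k::field mpoly set"
  assumes "J \<subseteq> carrier (poly_ring n)" "0 \<in> J" "\<And>f g. f \<in> J \<Longrightarrow> g \<in> J \<Longrightarrow> f + g \<in> J"
    "\<And>f g. f \<in> J \<Longrightarrow> g \<in> carrier (poly_ring n) \<Longrightarrow> g * f \<in> J"
  shows "ideal J (poly_ring n)"
proof (rule idealI)
  interpret cring "poly_ring n :: 'k mpoly ring" by (rule cring_poly_ring)
  have minus: "inv\<^bsub>add_monoid (poly_ring n)\<^esub> f = - f" if "f \<in> carrier (poly_ring n)" for f :: "'k mpoly"
    using that by (intro comm_inv_char add.comm_inv_char) (auto simp: in_carrier_poly_ring)
  have "- f \<in> J" if "f \<in> J" for f
    using assms(4)[OF that, of "- 1"] by (auto simp: in_carrier_poly_ring)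
  then show "subgroup J (add_monoid (poly_ring n))"
    using assms minus by (intro subgroup.intro) auto
qed (use assms ring_poly_ring in \<open>auto simp: mult.commute\<close>)

text \<open>The primes of the sets \<open>A\<close> and the star ideal all have this form, so
  intersecting the primes amounts to combining conditions on exponents.\<close>

definition monomial_span :: "nat \<Rightarrow> ((nat \<Rightarrow>\<^sub>0 nat) \<Rightarrow> bool) \<Rightarrow> 'k::field mpoly set" where
  "monomial_span n M = {f \<in> carrier (poly_ring n). \<forall>k\<in>Poly_Mapping.keys f. M k}"

lemma ideal_monomial_span:
  assumes "\<And>k l. M k \<Longrightarrow> M (k + l)"
  shows "ideal (monomial_span n M :: 'k::field mpoly set) (poly_ring n)"
proof (rule poly_ring_idealI)
  interpret cring "poly_ring n :: 'k mpoly ring" by (rule cring_poly_ring)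
  fix f g :: "'k mpoly"
  show "f + g \<in> monomial_span n M" if "f \<in> monomial_span n M" "g \<in> monomial_span n M"
    using that a_closed[of f g] keys_add[of f g] by (auto simp: monomial_span_def)
  show "g * f \<in> monomial_span n M" if f: "f \<in> monomial_span n M" and g: "g \<in> carrier (poly_ring n)"
    unfolding monomial_span_def
  proof (intro CollectI conjI ballI)
    show "g * f \<in> carrier (poly_ring n)" using f g m_closed[of g f] by (simp add: monomial_span_def)
    fix u assume "u \<in> Poly_Mapping.keys (g * f)"
    then obtain a b where "u = a + b" "b \<in> Poly_Mapping.keys f"
      using keys_mult[of g f] by blast
    then show "M u" using f assms[of b a] by (simp add: monomial_span_def add.commute)
  qed
qed (auto simp: monomial_span_def in_carrier_poly_ring)

text \<open>An ideal absorbs the coefficients, and \<open>f\<close> is the finite sum of its terms.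
  Containment questions thereby reduce to single monomials.\<close>

lemma in_ideal_if_monomials:
  fixes J :: "'k::field mpoly set"
  assumes J: "ideal J (poly_ring n)" and f: "f \<in> carrier (poly_ring n)"
    and "\<And>k. k \<in> Poly_Mapping.keys f \<Longrightarrow> Poly_Mapping.single k 1 \<in> J"
  shows "f \<in> J"
proof -
  interpret ideal J "poly_ring n" by (rule J)
  have single: "Poly_Mapping.single k (Poly_Mapping.lookup f k) \<in> J"
    if "k \<in> Poly_Mapping.keys f" for k
  proof -
    have "Poly_Mapping.single 0 (Poly_Mapping.lookup f k) \<in> carrier (poly_ring n)"
      by (auto simp: in_carrier_poly_ring)
    from I_l_closed[OF assms(3)[OF that] this] show ?thesis
      by (simp add: mult_single)
  qed
  have "(\<Sum>k\<in>K. Poly_Mapping.single k (Poly_Mapping.lookup f k)) \<in> J"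
    if "K \<subseteq> Poly_Mapping.keys f" for K
    using finite_subset[OF that finite_keys] that
  proof (induction K rule: finite_induct)
    case empty
    then show ?case using additive_subgroup.zero_closed[OF additive_subgroup_axioms] by simp
  next
    case (insert k K)
    then show ?case
      using additive_subgroup.a_closed[OF additive_subgroup_axioms single[of k]] by simp
  qed
  from this[OF order_refl] show ?thesis by (subst poly_mapping_expand)
qed

text \<open>A monomial whose support meets \<open>A\<close> is a multiple of some variable from
  \<open>A\<close>.\<close>

lemma genideal_vars:
  assumes A: "A \<subseteq> {0..n}"
  shows "Idl\<^bsub>poly_ring n\<^esub> (var ` A) =
    (monomial_span n (\<lambda>k. Poly_Mapping.keys k \<inter> A \<noteq> {}) :: 'k::field mpoly set)"
    (is "_ = ?M")
proof -
  interpret ring "poly_ring n :: 'k mpoly ring" by (rule ring_poly_ring)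
  have fin: "finite A" using A finite_subset by blast
  have vars: "var ` A \<subseteq> carrier (poly_ring n :: 'k mpoly ring)"
    using A by (auto intro!: var_in_carrier)
  have idM: "ideal ?M (poly_ring n)"
    unfolding weight_pos_iff[OF fin, symmetric]
    by (rule ideal_monomial_span) (simp add: weight_add)
  show ?thesis
  proof
    have "var ` A \<subseteq> ?M"
      using vars by (auto simp: monomial_span_def var_def)
    then show "Idl\<^bsub>poly_ring n\<^esub> (var ` A) \<subseteq> ?M"
      using genideal_minimal[OF idM] by blast
  next
    show "?M \<subseteq> Idl\<^bsub>poly_ring n\<^esub> (var ` A)"
    proof
      fix f assume f: "f \<in> ?M"
      show "f \<in> Idl\<^bsub>poly_ring n\<^esub> (var ` A)"
      proof (rule in_ideal_if_monomials[OF genideal_ideal[OF vars]])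
        show "f \<in> carrier (poly_ring n)" using f by (simp add: monomial_span_def)
        fix k assume "k \<in> Poly_Mapping.keys f"
        then obtain i where i: "i \<in> A" "i \<in> Poly_Mapping.keys k" "Poly_Mapping.keys k \<subseteq> {0..n}"
          using f unfolding monomial_span_def in_carrier_poly_ring by blast
        \<comment> \<open>Truncated subtraction is exact here because \<open>i\<close> lies in the
          support of \<open>k\<close>.\<close>
        let ?l = "k - Poly_Mapping.single i 1"
        have "k = ?l + Poly_Mapping.single i 1"
          using i(2) by (auto intro!: poly_mapping_eqI
              simp: lookup_add lookup_minus lookup_single when_def in_keys_iff)
        then have "Poly_Mapping.single k (1::'k) = Poly_Mapping.single ?l 1 * var i"
          by (simp add: var_def mult_single)
        moreover have "Poly_Mapping.keys ?l \<subseteq> {0..n}"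
          using i(3) by (auto simp: in_keys_iff lookup_minus)
        then have "Poly_Mapping.single ?l (1::'k) \<in> carrier (poly_ring n)"
          by (simp add: in_carrier_poly_ring)
        moreover have "var i \<in> Idl\<^bsub>poly_ring n\<^esub> (var ` A :: 'k mpoly set)"
          using genideal_self[OF vars] i(1) by blast
        ultimately show "Poly_Mapping.single k 1 \<in> Idl\<^bsub>poly_ring n\<^esub> (var ` A :: 'k mpoly set)"
          using ideal.I_l_closed[OF genideal_ideal[OF vars]] by simp
      qed
    qed
  qed
qed

text \<open>The least weights of \<open>f\<close> and \<open>g\<close> add up to the weight of a
  monomial of the product. If that weight is positive, one of the two least weights is.\<close>

lemma primeideal_vars:
  assumes A: "A \<subseteq> {0..n}"
  shows "primeideal (monomial_span n (\<lambda>k. Poly_Mapping.keys k \<inter> A \<noteq> {}) :: 'k::field mpoly set)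
    (poly_ring n)" (is "primeideal ?M _")
proof (rule primeidealI)
  have fin: "finite A" using A finite_subset by blast
  show "ideal ?M (poly_ring n)"
    unfolding weight_pos_iff[OF fin, symmetric]
    by (rule ideal_monomial_span) (simp add: weight_add)
  show "cring (poly_ring n :: 'k mpoly ring)" by (rule cring_poly_ring)
  have "1 \<in> carrier (poly_ring n) - ?M"
    by (auto simp: monomial_span_def in_carrier_poly_ring)
  then show "carrier (poly_ring n) \<noteq> ?M" by blast
  fix f g :: "'k mpoly"
  assume f: "f \<in> carrier (poly_ring n)" and g: "g \<in> carrier (poly_ring n)"
    and fg: "f \<otimes>\<^bsub>poly_ring n\<^esub> g \<in> ?M"
  show "f \<in> ?M \<or> g \<in> ?M"
  proof (cases "f = 0 \<or> g = 0")
    case True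
    then show ?thesis by (auto simp: monomial_span_def in_carrier_poly_ring)
  next
    case False
    then obtain u k l where *: "u \<in> Poly_Mapping.keys (f * g)"
      "weight A u = weight A k + weight A l"
      "\<And>k'. k' \<in> Poly_Mapping.keys f \<Longrightarrow> weight A k \<le> weight A k'"
      "\<And>l'. l' \<in> Poly_Mapping.keys g \<Longrightarrow> weight A l \<le> weight A l'"
      using keys_mult_min_weight[of f g A] by metis
    have "weight A u > 0"
      using fg *(1) unfolding monomial_span_def weight_pos_iff[OF fin, symmetric] by simp
    then consider "weight A k > 0" | "weight A l > 0" using * by linarith
    then show ?thesis
      unfolding monomial_span_def weight_pos_iff[OF fin, symmetric]
      using * f g by cases fastforce+
  qed
qed

section \<open>Powers of the star ideal\<close>

text \<open>A support \<open>K\<close> meets every \<open>c\<close>-subset of \<open>{0..n}\<close>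
  exactly when its complement, of size \<open>n + 1 - card K\<close>, is too small to contain
  one.\<close>

lemma star_ideal_eq:
  assumes "c \<le> n"
  shows "(star_ideal n c :: 'k::field mpoly set) =
    monomial_span n (\<lambda>k. n - c + 2 \<le> card (Poly_Mapping.keys k))"
proof -
  have eq: "(star_ideal n c :: 'k mpoly set) =
      (\<Inter>A\<in>{A. A \<subseteq> {0..n} \<and> card A = c}. monomial_span n (\<lambda>k. Poly_Mapping.keys k \<inter> A \<noteq> {}))"
    unfolding star_ideal_def by (rule INF_cong) (auto simp: genideal_vars)
  \<comment> \<open>At least one \<open>c\<close>-subset must exist, for an empty intersection would
    be the whole type and lose the restriction to \<open>S(n)\<close>.\<close>
  have ex: "{A. A \<subseteq> {0..n} \<and> card A = c} \<noteq> {}"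
    using obtain_subset_with_card_n[of c "{0..n}"] assms by fastforce
  have iff: "(\<forall>A. A \<subseteq> {0..n} \<and> card A = c \<longrightarrow> K \<inter> A \<noteq> {}) \<longleftrightarrow> n - c + 2 \<le> card K"
    if K: "K \<subseteq> {0..n}" for K
  proof -
    have fin: "finite K" using K finite_subset by blast
    have card: "card ({0..n} - K) = n + 1 - card K"
      using K by (simp add: card_Diff_subset fin)
    have le: "card K \<le> n + 1" using card_mono[OF _ K] by simp
    show ?thesis
    proof
      assume *: "\<forall>A. A \<subseteq> {0..n} \<and> card A = c \<longrightarrow> K \<inter> A \<noteq> {}"
      show "n - c + 2 \<le> card K"
      proof (rule ccontr)
        assume "\<not> ?thesis"
        then have "c \<le> card ({0..n} - K)" using card assms by simp
        then obtain A where "A \<subseteq> {0..n} - K" "card A = c"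
          using obtain_subset_with_card_n by metis
        then show False using * by blast
      qed
    next
      assume d: "n - c + 2 \<le> card K"
      show "\<forall>A. A \<subseteq> {0..n} \<and> card A = c \<longrightarrow> K \<inter> A \<noteq> {}"
      proof (intro allI impI notI)
        fix A assume A: "A \<subseteq> {0..n} \<and> card A = c" "K \<inter> A = {}"
        then have "card A \<le> card ({0..n} - K)" by (intro card_mono) auto
        then show False using A d card le assms by linarith
      qed
    qed
  qed
  show ?thesis
  proof (rule Set.set_eqI)
    fix f :: "'k mpoly"
    have "f \<in> star_ideal n c \<longleftrightarrow> f \<in> carrier (poly_ring n) \<and>
        (\<forall>k\<in>Poly_Mapping.keys f. \<forall>A. A \<subseteq> {0..n} \<and> card A = c \<longrightarrow> Poly_Mapping.keys k \<inter> A \<noteq> {})"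
      unfolding eq monomial_span_def using ex by blast
    also have "\<dots> \<longleftrightarrow> f \<in> monomial_span n (\<lambda>k. n - c + 2 \<le> card (Poly_Mapping.keys k))"
      unfolding monomial_span_def in_carrier_poly_ring mem_Collect_eq
      by (intro conj_cong ball_cong refl iff) blast
    finally show "f \<in> star_ideal n c \<longleftrightarrow>
      f \<in> monomial_span n (\<lambda>k. n - c + 2 \<le> card (Poly_Mapping.keys k))" .
  qed
qed

lemma keys_add_nat: "Poly_Mapping.keys (k + l) = Poly_Mapping.keys k \<union> Poly_Mapping.keys l"
  for k l :: "'a \<Rightarrow>\<^sub>0 nat"
  by (auto simp: in_keys_iff lookup_add)

lemma ideal_star_ideal:
  assumes "c \<le> n"
  shows "ideal (star_ideal n c :: 'k::field mpoly set) (poly_ring n)"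
  unfolding star_ideal_eq[OF assms]
proof (rule ideal_monomial_span)
  fix k l :: "nat \<Rightarrow>\<^sub>0 nat"
  assume "n - c + 2 \<le> card (Poly_Mapping.keys k)"
  also have "\<dots> \<le> card (Poly_Mapping.keys (k + l))"
    by (rule card_mono) (auto simp: keys_add_nat)
  finally show "n - c + 2 \<le> card (Poly_Mapping.keys (k + l))" .
qed

lemma ideal_power_0: "ideal_power R I 0 = carrier R"
  by (simp add: ideal_power_def nat_pow_def ideals_set_def)

lemma ideal_power_Suc: "ideal_power R I (Suc r) = ideal_prod R (ideal_power R I r) I"
  by (simp add: ideal_power_def nat_pow_def ideals_set_def)

lemma (in ring) ideal_ideal_power:
  assumes "ideal I R"
  shows "ideal (ideal_power R I r) R"
  by (induction r) (auto simp: ideal_power_0 ideal_power_Suc oneideal ideal_prod_is_ideal assms)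

text \<open>Weights add in products, and sums create no new monomials. It serves twice: with
  \<open>e = 1\<close> for a \<open>c\<close>-subset \<open>A\<close>, and with
  \<open>e = n - c + 2\<close> for \<open>A = {0..n}\<close>, where the weight is the total
  degree.\<close>

lemma weight_ideal_power:
  assumes I: "\<And>f k. f \<in> I \<Longrightarrow> k \<in> Poly_Mapping.keys f \<Longrightarrow> weight A k \<ge> e"
    and f: "f \<in> ideal_power (poly_ring n) I r" "k \<in> Poly_Mapping.keys f"
  shows "weight A k \<ge> r * e"
  using f
proof (induction r arbitrary: f k)
  case (Suc r)
  from Suc.prems have "f \<in> ideal_prod (poly_ring n) (ideal_power (poly_ring n) I r) I"
    by (simp add: ideal_power_Suc)
  then have "\<forall>k\<in>Poly_Mapping.keys f. weight A k \<ge> Suc r * e"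
  proof induction
    case (prod i j)
    show ?case
    proof
      fix k assume "k \<in> Poly_Mapping.keys (i \<otimes>\<^bsub>poly_ring n\<^esub> j)"
      then obtain a b where "k = a + b" "a \<in> Poly_Mapping.keys i" "b \<in> Poly_Mapping.keys j"
        using keys_mult[of i j] by auto
      then show "weight A k \<ge> Suc r * e"
        using Suc.IH[OF prod(1), of a] I[OF prod(2), of b] by (simp add: weight_add)
    qed
  next
    case (sum s1 s2)
    then show ?case using keys_add[of s1 s2] by auto
  qed
  with Suc.prems show ?case by blast
qed simp

section \<open>Exponent criterion for monomials in powers of the star ideal\<close>

definition monomial_on :: "nat set \<Rightarrow> (nat \<Rightarrow> nat) \<Rightarrow> nat \<Rightarrow>\<^sub>0 nat" where
  "monomial_on A a = (\<Sum>i\<in>A. Poly_Mapping.single i (a i))"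

lemma lookup_monomial_on:
  "finite A \<Longrightarrow> Poly_Mapping.lookup (monomial_on A a) i = (if i \<in> A then a i else 0)"
  by (auto simp: monomial_on_def lookup_sum lookup_single when_def)

text \<open>
  The set \<open>D\<close> is chosen comparable by inclusion with the set of indices whose exponent exceeds \<open>r\<close>.
\<close>

lemma exists_squarefree_factor:
  fixes a :: "nat \<Rightarrow> nat"
  assumes fin: "finite N" and sum: "(\<Sum>i\<in>N. min (a i) (Suc r)) \<ge> Suc r * d"
  obtains D where "D \<subseteq> {i \<in> N. a i > 0}" "card D = d"
    "(\<Sum>i\<in>N. min (a i - (if i \<in> D then 1 else 0)) r) \<ge> r * d"
proof (cases "card {i \<in> N. a i > r} \<ge> d")
  case True
  then obtain D where D: "D \<subseteq> {i \<in> N. a i > r}" "card D = d"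
    using obtain_subset_with_card_n by metis
  \<comment> \<open>Each of these \<open>d\<close> exponents is still at least \<open>r\<close>
    after being lowered by one, so \<open>D\<close> alone supplies the bound.\<close>
  have "r * d = (\<Sum>i\<in>D. min (a i - (if i \<in> D then 1 else 0)) r)"
    using D by (subst sum.cong[OF refl, where h = "\<lambda>_. r"]) auto
  also have "\<dots> \<le> (\<Sum>i\<in>N. min (a i - (if i \<in> D then 1 else 0)) r)"
    by (rule sum_mono2) (use fin D in auto)
  finally show thesis using D by (intro that[of D]) auto
next
  case False
  \<comment> \<open>Each positive exponent contributes at most \<open>Suc r\<close>, so at least
    \<open>d\<close> of them must be positive.\<close>
  have "Suc r * d \<le> (\<Sum>i\<in>N. min (a i) (Suc r))" by (rule sum)
  also have "\<dots> = (\<Sum>i\<in>{i \<in> N. a i > 0}. min (a i) (Suc r))"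
    by (rule sum.mono_neutral_right) (use fin in auto)
  also have "\<dots> \<le> (\<Sum>i\<in>{i \<in> N. a i > 0}. Suc r)"
    by (rule sum_mono) auto
  finally have "Suc r * d \<le> Suc r * card {i \<in> N. a i > 0}" by (simp add: mult.commute)
  then have "d \<le> card {i \<in> N. a i > 0}" by (simp only: Suc_mult_le_cancel1)
  then obtain D where D: "{i \<in> N. a i > r} \<subseteq> D" "D \<subseteq> {i \<in> N. a i > 0}" "card D = d"
    using False fin exists_subset_between[of "{i \<in> N. a i > r}" d "{i \<in> N. a i > 0}"] by fastforce
  then have DN: "D \<subseteq> N" by blast
  \<comment> \<open>Lowering costs exactly \<open>d\<close>: on \<open>D\<close> one has
    \<open>a i > 0\<close>, so each summand drops by one; off \<open>D\<close> one has
    \<open>a i \<le> r\<close>, so truncating at \<open>r\<close> or at \<open>Suc r\<close> makes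
    no difference.\<close>
  have "(\<Sum>i\<in>N. min (a i - (if i \<in> D then 1 else 0)) r) + d =
      (\<Sum>i\<in>N. min (a i - (if i \<in> D then 1 else 0)) r) + (\<Sum>i\<in>N. if i \<in> D then 1 else 0)"
    using D(3) sum.inter_restrict[OF fin, of "\<lambda>_. 1::nat" D] DN by (simp add: Int_absorb1)
  also have "\<dots> = (\<Sum>i\<in>N. min (a i) (Suc r))"
    unfolding sum.distrib[symmetric]
    by (rule sum.cong) (use D in \<open>auto simp: min_def not_less\<close>)
  finally show thesis using D sum by (intro that[of D]) auto
qed

text \<open>One squarefree monomial of degree \<open>n - c + 2\<close> is split off per induction
  step. Exponents are truncated at \<open>r\<close> because \<open>r\<close> squarefree factors use
  each variable at most \<open>r\<close> times.\<close>

lemma monomial_in_star_power: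
  assumes c: "c \<le> n" and k: "Poly_Mapping.keys k \<subseteq> {0..n}"
    and sum: "(\<Sum>i\<in>{0..n}. min (Poly_Mapping.lookup k i) r) \<ge> r * (n - c + 2)"
  shows "Poly_Mapping.single k (1::'k::field) \<in> ideal_power (poly_ring n) (star_ideal n c) r"
  using k sum
proof (induction r arbitrary: k)
  case 0
  then show ?case by (simp add: ideal_power_0 in_carrier_poly_ring)
next
  case (Suc r)
  obtain D where D: "D \<subseteq> {i \<in> {0..n}. Poly_Mapping.lookup k i > 0}" "card D = n - c + 2"
    "(\<Sum>i\<in>{0..n}. min (Poly_Mapping.lookup k i - (if i \<in> D then 1 else 0)) r) \<ge> r * (n - c + 2)"
    using exists_squarefree_factor[OF _ Suc.prems(2)] by blast
  have finD: "finite D" using D(1) finite_subset by fastforce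
  define e where "e = monomial_on D (\<lambda>_. 1)"
  have le: "Poly_Mapping.lookup e i = (if i \<in> D then 1 else 0)" for i
    by (simp add: e_def lookup_monomial_on finD)
  have k: "k = (k - e) + e"
    using D(1) by (auto intro!: poly_mapping_eqI simp: lookup_add lookup_minus le)
  have "Poly_Mapping.single (k - e) (1::'k) \<in> ideal_power (poly_ring n) (star_ideal n c) r"
    using Suc.prems(1) D(3)
    by (intro Suc.IH) (auto simp: in_keys_iff lookup_minus le)
  moreover have "Poly_Mapping.keys e = D" by (auto simp: in_keys_iff le split: if_splits)
  then have "Poly_Mapping.single e (1::'k) \<in> star_ideal n c"
    using D by (auto simp: star_ideal_eq[OF c] monomial_span_def in_carrier_poly_ring)
  ultimately have "Poly_Mapping.single (k - e) 1 \<otimes>\<^bsub>poly_ring n\<^esub> Poly_Mapping.single e (1::'k)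
      \<in> ideal_power (poly_ring n) (star_ideal n c) (Suc r)"
    unfolding ideal_power_Suc by (rule ideal_prod.prod)
  then show ?case using k by (simp add: mult_single)
qed

section \<open>Symbolic powers of the star ideal\<close>

text \<open>The prime of \<open>A\<close> is the annihilator of the squarefree monomial in the variables outside \<open>A\<close>.\<close>

lemma vars_associated_star_ideal:
  assumes c: "c \<le> n" and A: "A \<subseteq> {0..n}" "card A = c"
  shows "(monomial_span n (\<lambda>k. Poly_Mapping.keys k \<inter> A \<noteq> {}) :: 'k::field mpoly set)
    \<in> associated_primes (poly_ring n) (star_ideal n c)"
proof -
  interpret cring "poly_ring n :: 'k mpoly ring" by (rule cring_poly_ring)
  define B where "B = {0..n} - A"
  define e where "e = monomial_on B (\<lambda>_. 1)"
  have fin: "finite A" "finite B" using A(1) finite_subset by (auto simp: B_def)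
  have keys: "Poly_Mapping.keys e = B" by (auto simp: in_keys_iff e_def lookup_monomial_on fin split: if_splits)
  have cardB: "card B = n + 1 - c" using A fin by (simp add: B_def card_Diff_subset)
  let ?f = "Poly_Mapping.single e (1::'k)"
  have f: "?f \<in> carrier (poly_ring n)" by (auto simp: in_carrier_poly_ring keys B_def)
  \<comment> \<open>Adding \<open>e\<close> is injective on exponents, so multiplication by
    \<open>?f\<close> causes no cancellation.\<close>
  have keys_shift: "Poly_Mapping.keys (g * ?f) = (\<lambda>k. k + e) ` Poly_Mapping.keys g"
    for g :: "'k mpoly"
  proof -
    have "g * ?f = (\<Sum>k\<in>Poly_Mapping.keys g. Poly_Mapping.single (k + e) (Poly_Mapping.lookup g k))"
      by (subst poly_mapping_expand[of g]) (simp add: sum_distrib_right mult_single)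
    then have l: "Poly_Mapping.lookup (g * ?f) u =
        (\<Sum>k\<in>Poly_Mapping.keys g. if k + e = u then Poly_Mapping.lookup g k else 0)" for u
      by (simp add: lookup_sum lookup_single when_def)
    have l2: "Poly_Mapping.lookup (g * ?f) (k + e) = Poly_Mapping.lookup g k" for k
      unfolding l by (simp add: in_keys_iff)
    show ?thesis
    proof (intro Set.set_eqI iffI)
      fix u assume "u \<in> Poly_Mapping.keys (g * ?f)"
      then show "u \<in> (\<lambda>k. k + e) ` Poly_Mapping.keys g"
        using keys_mult[of g ?f] by auto
    qed (auto simp: in_keys_iff l2)
  qed
  \<comment> \<open>The \<open>n + 1 - c\<close> variables outside \<open>A\<close> are all supplied
    by \<open>e\<close>; the missing one must come from \<open>A\<close>.\<close>
  have cond: "n - c + 2 \<le> card (Poly_Mapping.keys (k + e)) \<longleftrightarrow> Poly_Mapping.keys k \<inter> A \<noteq> {}"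
    if k: "Poly_Mapping.keys k \<subseteq> {0..n}" for k
  proof -
    have "Poly_Mapping.keys (k + e) = (Poly_Mapping.keys k \<inter> A) \<union> B"
      using k by (auto simp: keys_add_nat keys B_def)
    moreover have "card ((Poly_Mapping.keys k \<inter> A) \<union> B) = card (Poly_Mapping.keys k \<inter> A) + card B"
      by (rule card_Un_disjoint) (auto simp: B_def fin)
    ultimately have "n - c + 2 \<le> card (Poly_Mapping.keys (k + e)) \<longleftrightarrow>
        card (Poly_Mapping.keys k \<inter> A) > 0"
      using cardB c by auto
    then show ?thesis by (simp add: card_gt_0_iff)
  qed
  have "monomial_span n (\<lambda>k. Poly_Mapping.keys k \<inter> A \<noteq> {}) =
      {g \<in> carrier (poly_ring n). g \<otimes>\<^bsub>poly_ring n\<^esub> ?f \<in> star_ideal n c}"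
  proof (rule Set.set_eqI)
    fix g :: "'k mpoly"
    show "g \<in> monomial_span n (\<lambda>k. Poly_Mapping.keys k \<inter> A \<noteq> {}) \<longleftrightarrow>
      g \<in> {g \<in> carrier (poly_ring n). g \<otimes>\<^bsub>poly_ring n\<^esub> ?f \<in> star_ideal n c}"
    proof (cases "g \<in> carrier (poly_ring n)")
      case True
      then have "g * ?f \<in> carrier (poly_ring n)" using m_closed[OF _ f] by simp
      then show ?thesis
        using True cond
        by (simp add: star_ideal_eq[OF c] monomial_span_def keys_shift in_carrier_poly_ring)
    qed (simp add: monomial_span_def)
  qed
  then show ?thesis
    unfolding associated_primes_def using primeideal_vars[OF A(1)] f by blast
qed

text \<open>Localizing at the prime of \<open>A\<close> gives \<open>s\<close> outside that prime
  with \<open>f * s\<close> in the ordinary power. Such an \<open>s\<close> has a monomial of weight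
  0, so \<open>f\<close> and \<open>f * s\<close> have the same least weight, which is at least
  \<open>m\<close>.\<close>

lemma weight_symbolic_power:
  fixes f :: "'k::field mpoly"
  assumes c: "c \<le> n" and A: "A \<subseteq> {0..n}" "card A = c"
    and f: "f \<in> symbolic_power n (star_ideal n c) m" and k: "k \<in> Poly_Mapping.keys f"
  shows "weight A k \<ge> m"
proof -
  let ?P = "monomial_span n (\<lambda>k. Poly_Mapping.keys k \<inter> A \<noteq> {}) :: 'k mpoly set"
  have fin: "finite A" using A(1) finite_subset by blast
  have "Fract f 1 \<in> localized_ideal n (ideal_power (poly_ring n) (star_ideal n c) m) ?P"
    using f vars_associated_star_ideal[OF c A] by (auto simp: symbolic_power_def)
  then obtain a s where a: "a \<in> ideal_power (poly_ring n) (star_ideal n c) m"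
    and s: "s \<in> carrier (poly_ring n)" "s \<notin> ?P" and fr: "Fract f 1 = Fract a s"
    by (auto simp: localized_ideal_def)
  obtain l0 where l0: "l0 \<in> Poly_Mapping.keys s" "weight A l0 = 0"
    using s unfolding monomial_span_def weight_pos_iff[OF fin, symmetric] by blast
  then have "s \<noteq> 0" by auto
  with fr have fs: "f * s = a" by (simp add: eq_fract)
  have "f \<noteq> 0" using k by auto
  with \<open>s \<noteq> 0\<close> obtain u k0 l where *: "u \<in> Poly_Mapping.keys (f * s)"
      "weight A u = weight A k0 + weight A l"
      "\<And>k'. k' \<in> Poly_Mapping.keys f \<Longrightarrow> weight A k0 \<le> weight A k'"
      "\<And>l'. l' \<in> Poly_Mapping.keys s \<Longrightarrow> weight A l \<le> weight A l'"
    using keys_mult_min_weight[of f s A] by metis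
  have "m * 1 \<le> weight A u"
  proof (rule weight_ideal_power[OF _ a])
    show "u \<in> Poly_Mapping.keys a" using * fs by simp
    fix g :: "'k mpoly" and v assume "g \<in> star_ideal n c" "v \<in> Poly_Mapping.keys g"
    then have "g \<in> ?P"
      using A by (auto simp: star_ideal_def genideal_vars)
    then have "weight A v > 0"
      using \<open>v \<in> _\<close> by (simp add: weight_pos_iff[OF fin] monomial_span_def)
    then show "1 \<le> weight A v" by simp
  qed
  moreover have "weight A l = 0" using *(4)[OF l0(1)] l0(2) by simp
  ultimately show ?thesis using *(2) *(3)[OF k] by simp
qed

text \<open>The associated primes need not be classified. Each is a colon ideal \<open>Q\<close> of
  some \<open>f\<close>, and \<open>f\<close> avoids the prime of some \<open>A\<close>; that prime
  then contains \<open>Q\<close>, so monomials in the variables outside \<open>A\<close> are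
  admissible denominators.\<close>

lemma constant_exponents_in_symbolic_power:
  assumes c: "c \<le> n"
  shows "Poly_Mapping.single (monomial_on {0..n} (\<lambda>_. t)) (1::'k::field)
    \<in> symbolic_power n (star_ideal n c) (c * t)" (is "?x \<in> _")
proof -
  interpret cring "poly_ring n :: 'k mpoly ring" by (rule cring_poly_ring)
  let ?J = "ideal_power (poly_ring n) (star_ideal n c) (c * t) :: 'k mpoly set"
  have x: "?x \<in> carrier (poly_ring n)"
    by (auto simp: in_carrier_poly_ring lookup_monomial_on in_keys_iff split: if_splits)
  have "Fract ?x 1 \<in> localized_ideal n ?J Q"
    if Q: "Q \<in> associated_primes (poly_ring n) (star_ideal n c)" for Q
  proof -
    obtain f where f: "f \<in> carrier (poly_ring n)"
      and Qf: "Q = {g \<in> carrier (poly_ring n). g * f \<in> star_ideal n c}" and pr: "primeideal Q (poly_ring n)"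
      using Q by (auto simp: associated_primes_def)
    have "Q \<noteq> carrier (poly_ring n)" using pr primeideal.I_notcarr by blast
    \<comment> \<open>If \<open>f\<close> were in the star ideal, \<open>Q\<close> would be the
      whole ring.\<close>
    then have "f \<notin> star_ideal n c"
      using Qf f ideal.I_l_closed[OF ideal_star_ideal[OF c]] by auto
    then obtain A where A: "A \<subseteq> {0..n}" "card A = c"
      and fA: "f \<notin> monomial_span n (\<lambda>k. Poly_Mapping.keys k \<inter> A \<noteq> {})"
      by (auto simp: star_ideal_def genideal_vars)
    have fin: "finite A" using A(1) finite_subset by blast
    \<comment> \<open>The exponent \<open>c * t\<close> equals the power, so each variable outside
      \<open>A\<close> reaches the truncation bound.\<close>
    define b where "b = monomial_on ({0..n} - A) (\<lambda>_. c * t)"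
    have lb: "Poly_Mapping.lookup b i = (if i \<in> {0..n} - A then c * t else 0)" for i
      unfolding b_def by (rule lookup_monomial_on) simp
    let ?s = "Poly_Mapping.single b (1::'k)"
    have s: "?s \<in> carrier (poly_ring n)"
      by (auto simp: in_carrier_poly_ring lb in_keys_iff split: if_splits)
    have "?s \<notin> Q"
    proof
      assume "?s \<in> Q"
      then have "?s * f \<in> star_ideal n c" using Qf by blast
      then have "?s * f \<in> monomial_span n (\<lambda>k. Poly_Mapping.keys k \<inter> A \<noteq> {})"
        using A by (auto simp: star_ideal_def genideal_vars)
      then have "?s \<in> monomial_span n (\<lambda>k. Poly_Mapping.keys k \<inter> A \<noteq> {})"
        using primeideal.I_prime[OF primeideal_vars[OF A(1)] s f] fA by auto
      then show False
        by (auto simp: monomial_span_def in_keys_iff lb split: if_splits)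
    qed
    moreover have "?s * ?x \<in> ?J"
      unfolding mult_single
    proof (simp only: mult_1, rule monomial_in_star_power[OF c])
      let ?k = "b + monomial_on {0..n} (\<lambda>_. t)"
      show "Poly_Mapping.keys ?k \<subseteq> {0..n}"
        by (auto simp: in_keys_iff lookup_add lb lookup_monomial_on split: if_splits)
      have lk: "min (Poly_Mapping.lookup ?k i) (c * t) \<ge> (if i \<in> A then min t (c * t) else c * t)"
        if "i \<in> {0..n}" for i
        using that by (auto simp: lookup_add lb lookup_monomial_on)
      \<comment> \<open>For \<open>c > 0\<close> the minimum is \<open>t\<close>; for
        \<open>c = 0\<close> both sides vanish.\<close>
      have min: "c * min t (c * t) = c * t"
        by (cases c) auto
      \<comment> \<open>The \<open>c\<close> variables in \<open>A\<close> contribute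
        \<open>t\<close> each, the \<open>n + 1 - c\<close> others \<open>c * t\<close> each, which
        meets the criterion with equality.\<close>
      have "c * t * (n - c + 2) = c * t + (n + 1 - c) * (c * t)"
        using c by (simp add: algebra_simps Suc_diff_le)
      also have "\<dots> = (\<Sum>i\<in>{0..n}. if i \<in> A then min t (c * t) else c * t)"
      proof -
        have "{0..n} \<inter> {i. i \<in> A} = A" "{0..n} \<inter> - {i. i \<in> A} = {0..n} - A"
          using A by auto
        moreover have "card ({0..n} - A) = n + 1 - c"
          using A fin by (simp add: card_Diff_subset)
        ultimately show ?thesis
          using A(2) min by (simp only: sum.If_cases finite_atLeastAtMost sum_constant of_nat_id)
      qed
      also have "\<dots> \<le> (\<Sum>i\<in>{0..n}. min (Poly_Mapping.lookup ?k i) (c * t))"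
        by (rule sum_mono) (rule lk)
      finally show "c * t * (n - c + 2) \<le> \<dots>" .
    qed
    moreover have "?s \<noteq> 0"
      by (metis lookup_single_eq lookup_zero zero_neq_one)
    then have "Fract ?x 1 = Fract (?s * ?x) ?s"
      by (simp add: eq_fract mult.commute)
    ultimately show ?thesis
      unfolding localized_ideal_def using s by blast
  qed
  then show ?thesis using x by (auto simp: symbolic_power_def)
qed

section \<open>Comparison of symbolic and ordinary powers\<close>

text \<open>The largest \<open>a i\<close> is at least \<open>m / c\<close>, so it can be split off.\<close>

lemma sum_ge_average:
  fixes a :: "nat \<Rightarrow> nat"
  assumes "finite B" "c \<le> card B" "c > 0"
    and "\<And>A. A \<subseteq> B \<Longrightarrow> card A = c \<Longrightarrow> sum a A \<ge> m"
  shows "c * sum a B \<ge> card B * m"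
  using assms
proof (induction "card B" arbitrary: B)
  case (Suc b)
  show ?case
  proof (cases "c = card B")
    case True
    then show ?thesis using Suc.prems(4)[of B] by simp
  next
    case False
    then have cb: "c \<le> b" using Suc.hyps(2) Suc.prems(2) by linarith
    have "B \<noteq> {}" using Suc.hyps(2) by auto
    then have "Max (a ` B) \<in> a ` B" using Suc.prems(1) by (intro Max_in) auto
    then obtain x where xB: "x \<in> B" and ax: "Max (a ` B) = a x" by (rule imageE)
    have x: "x \<in> B" "\<And>y. y \<in> B \<Longrightarrow> a y \<le> a x"
      using xB Suc.prems(1) by (simp_all flip: ax)
    have cardx: "b = card (B - {x})" using Suc.hyps(2) x Suc.prems(1) by simp
    then have IH: "b * m \<le> c * sum a (B - {x})"
      using Suc.hyps(1)[OF cardx] Suc.prems cb by auto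
    \<comment> \<open>The removed maximum \<open>a x\<close> bounds every remaining value, so the
      induction hypothesis forces \<open>m \<le> c * a x\<close>.\<close>
    also have "\<dots> \<le> c * (b * a x)"
      using sum_bounded_above[of "B - {x}" a "a x"] x cardx by (intro mult_le_mono2) auto
    finally have "b * m \<le> b * (c * a x)" by (simp add: ac_simps)
    then have "m \<le> c * a x" using cb Suc.prems(3) by simp
    moreover have "sum a B = a x + sum a (B - {x})"
      using x Suc.prems(1) by (simp add: sum.remove)
    ultimately show ?thesis
      using IH unfolding Suc.hyps(2)[symmetric] by (simp add: algebra_simps)
  qed
qed simp

text \<open>With \<open>N = n + 1\<close>, exponents of at least \<open>r\<close> form
  \<open>K\<close> and contribute \<open>r\<close> each. If \<open>K\<close> has fewer than
  \<open>d\<close> elements, averaging over the rest \<open>B\<close> gives at least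
  \<open>card B * d * r / N\<close>, and \<open>d \<le> N\<close> gives
  \<open>card K * r \<ge> card K * d * r / N\<close>; together these make
  \<open>d * r\<close>.\<close>

lemma symbolic_subset_power:
  assumes c: "1 \<le> c" "c \<le> n" and m: "c * (n - c + 2) * r \<le> m * (n + 1)"
  shows "symbolic_power n (star_ideal n c) m
    \<subseteq> ideal_power (poly_ring n) (star_ideal n c :: 'k::field mpoly set) r"
proof
  interpret ring "poly_ring n :: 'k mpoly ring" by (rule ring_poly_ring)
  fix f :: "'k mpoly" assume f: "f \<in> symbolic_power n (star_ideal n c) m"
  then have fc: "f \<in> carrier (poly_ring n)" by (simp add: symbolic_power_def)
  show "f \<in> ideal_power (poly_ring n) (star_ideal n c) r"
  proof (rule in_ideal_if_monomials[OF ideal_ideal_power[OF ideal_star_ideal[OF c(2)]] fc])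
    fix k assume k: "k \<in> Poly_Mapping.keys f"
    then have keys: "Poly_Mapping.keys k \<subseteq> {0..n}" using fc by (simp add: in_carrier_poly_ring)
    define d where "d = n - c + 2"
    let ?a = "Poly_Mapping.lookup k"
    define K where "K = {i \<in> {0..n}. ?a i \<ge> r}"
    define B where "B = {i \<in> {0..n}. ?a i < r}"
    have KB: "{0..n} = K \<union> B" "K \<inter> B = {}" "finite K" "finite B"
      by (auto simp: K_def B_def)
    then have card: "n + 1 = card K + card B"
      using card_Un_disjoint[of K B] by (metis Suc_eq_plus1 card_atLeastAtMost diff_zero)
    have sum: "(\<Sum>i\<in>{0..n}. min (?a i) r) = card K * r + sum ?a B"
    proof -
      have "(\<Sum>i\<in>{0..n}. min (?a i) r) = (\<Sum>i\<in>K. min (?a i) r) + (\<Sum>i\<in>B. min (?a i) r)"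
        unfolding KB(1) by (rule sum.union_disjoint) (use KB in auto)
      also have "(\<Sum>i\<in>K. min (?a i) r) = (\<Sum>i\<in>K. r)"
        by (rule sum.cong) (auto simp: K_def)
      also have "(\<Sum>i\<in>B. min (?a i) r) = sum ?a B"
        by (rule sum.cong) (auto simp: B_def)
      finally show ?thesis by simp
    qed
    have "r * d \<le> (\<Sum>i\<in>{0..n}. min (?a i) r)"
    proof (cases "d \<le> card K")
      case True
      then have "r * d \<le> card K * r" by (simp add: mult.commute)
      then show ?thesis using sum by linarith
    next
      case False
      \<comment> \<open>From \<open>card K \<le> n - c + 1\<close>, exactly enough indices remain in
        \<open>B\<close> for a \<open>c\<close>-subset.\<close>
      then have cB: "c \<le> card B" using card c by (simp add: d_def)
      have ge: "sum ?a A \<ge> m" if "A \<subseteq> B" "card A = c" for A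
      proof -
        have "A \<subseteq> {0..n}" using that KB by blast
        from weight_symbolic_power[OF c(2) this that(2) f k] show ?thesis
          by (simp add: weight_def)
      qed
      have avg: "card B * m \<le> c * sum ?a B"
        by (rule sum_ge_average[OF KB(4) cB _ ge]) (use c in simp_all)
      have "c * (card B * (d * r)) \<le> card B * (m * (n + 1))"
        using mult_le_mono2[OF m, of "card B"] unfolding d_def[symmetric] by (simp only: ac_simps)
      also have "\<dots> \<le> (n + 1) * (c * sum ?a B)"
        using mult_le_mono2[OF avg, of "n + 1"] by (simp only: ac_simps)
      finally have "c * (card B * (d * r)) \<le> c * ((n + 1) * sum ?a B)" by (simp only: ac_simps)
      then have *: "card B * (d * r) \<le> (n + 1) * sum ?a B" using c by simp
      \<comment> \<open>This is where \<open>c \<ge> 1\<close> bounds the contribution of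
        \<open>K\<close>.\<close>
      have dn: "d \<le> n + 1" using c by (simp add: d_def)
      have "(n + 1) * (r * d) = card K * (d * r) + card B * (d * r)"
        unfolding card by (simp add: algebra_simps)
      also have "\<dots> \<le> card K * ((n + 1) * r) + (n + 1) * sum ?a B"
        by (rule add_mono[OF mult_le_mono2[OF mult_le_mono1[OF dn]] *])
      also have "\<dots> = (n + 1) * (card K * r + sum ?a B)" by (simp add: algebra_simps)
      finally have "r * d \<le> card K * r + sum ?a B"
        by (rule mult_left_le_imp_le) simp
      then show ?thesis using sum by simp
    qed
    then show "Poly_Mapping.single k 1 \<in> ideal_power (poly_ring n) (star_ideal n c :: 'k mpoly set) r"
      using monomial_in_star_power[OF c(2) keys] by (simp add: d_def)
  qed
qed

text \<open>Monomials of the star ideal have degree at least \<open>n - c + 2\<close>, which is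
  multiplied by \<open>r\<close> in the power, whereas the constant-exponent monomial only has
  degree \<open>(n + 1) * t\<close>.\<close>

lemma symbolic_not_subset_power:
  assumes c: "c \<le> n" and r: "(n + 1) * t < r * (n - c + 2)"
  shows "\<not> symbolic_power n (star_ideal n c) (c * t)
    \<subseteq> ideal_power (poly_ring n) (star_ideal n c :: 'k::field mpoly set) r"
proof
  let ?k = "monomial_on {0..n} (\<lambda>_. t)"
  assume "symbolic_power n (star_ideal n c) (c * t)
    \<subseteq> ideal_power (poly_ring n) (star_ideal n c :: 'k mpoly set) r"
  then have x: "Poly_Mapping.single ?k (1::'k) \<in> ideal_power (poly_ring n) (star_ideal n c) r"
    using constant_exponents_in_symbolic_power[OF c] by blast
  have "r * (n - c + 2) \<le> weight {0..n} ?k"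
  proof (rule weight_ideal_power[OF _ x])
    fix g :: "'k mpoly" and v assume g: "g \<in> star_ideal n c" "v \<in> Poly_Mapping.keys g"
    then have v: "n - c + 2 \<le> card (Poly_Mapping.keys v)" "Poly_Mapping.keys v \<subseteq> {0..n}"
      by (auto simp: star_ideal_eq[OF c] monomial_span_def in_carrier_poly_ring)
    have "card (Poly_Mapping.keys v) = (\<Sum>i\<in>Poly_Mapping.keys v. 1)" by simp
    also have "\<dots> \<le> (\<Sum>i\<in>Poly_Mapping.keys v. Poly_Mapping.lookup v i)"
      by (rule sum_mono) (simp add: in_keys_iff Suc_leI)
    also have "\<dots> \<le> weight {0..n} v"
      unfolding weight_def by (rule sum_mono2) (use v in auto)
    finally show "n - c + 2 \<le> weight {0..n} v" using v by linarith
  qed simp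
  also have "\<dots> = (n + 1) * t"
    by (simp add: weight_def lookup_monomial_on)
  finally show False using r by simp
qed

section \<open>The supremum of the quotients\<close>

theorem theoremC:
  fixes n c :: nat
  assumes "n \<ge> 1" and "1 \<le> c" and "c \<le> n"
  shows "resurgence n (star_ideal n c :: 'k::field mpoly set)
           = ereal (real c * (real n - real c + 2) / (real n + 1))"
proof (rule antisym)
  define d where "d = n - c + 2"
  have d: "real n - real c + 2 = real d" "d > 0" using assms by (simp_all add: d_def)
  let ?I = "star_ideal n c :: 'k mpoly set"
  let ?S = "{ereal (real m / real r) | m r. m > 0 \<and> r > 0 \<and>
    \<not> symbolic_power n ?I m \<subseteq> ideal_power (poly_ring n) ?I r}"
  show "resurgence n ?I \<le> ereal (real c * (real n - real c + 2) / (real n + 1))"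
    unfolding resurgence_def
  proof (rule Sup_least)
    fix x assume "x \<in> ?S"
    then obtain m r where x: "x = ereal (real m / real r)" and "r > 0"
      and "\<not> symbolic_power n ?I m \<subseteq> ideal_power (poly_ring n) ?I r" by blast
    then have "m * (n + 1) < c * d * r"
      using symbolic_subset_power[OF assms(2,3), of r m] by (force simp: d_def)
    then have "real m * (real n + 1) \<le> real c * real d * real r"
      by (metis less_imp_le of_nat_1 of_nat_add of_nat_le_iff of_nat_mult)
    then show "x \<le> ereal (real c * (real n - real c + 2) / (real n + 1))"
      using \<open>r > 0\<close> unfolding d x by (simp add: field_simps)
  qed
  \<comment> \<open>Non-containment forces the strict inequality
    \<open>m * (n + 1) < c * d * r\<close>, so the supremum is not attained and a sequence is
    needed. For \<open>t = d * Suc s\<close>, the least \<open>r\<close> with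
    \<open>(n + 1) * t < r * d\<close> is \<open>(n + 1) * Suc s + 1\<close>; \<open>Suc s\<close>
    keeps \<open>m\<close> positive.\<close>
  define q where "q s = real (c * (d * Suc s)) / real ((n + 1) * Suc s + 1)" for s
  have "ereal (q s) \<in> ?S" for s
  proof -
    have "(n + 1) * (d * Suc s) < ((n + 1) * Suc s + 1) * d"
      using d(2) by (simp add: algebra_simps)
    then have "\<not> symbolic_power n ?I (c * (d * Suc s))
        \<subseteq> ideal_power (poly_ring n) ?I ((n + 1) * Suc s + 1)"
      unfolding d_def by (rule symbolic_not_subset_power[OF assms(3)])
    moreover have "c * (d * Suc s) > 0" using assms d(2) by simp
    ultimately show ?thesis
      unfolding q_def by (intro CollectI exI[of _ "c * (d * Suc s)"] exI[of _ "(n + 1) * Suc s + 1"]) simp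
  qed
  then have le: "ereal (q s) \<le> resurgence n ?I" for s
    unfolding resurgence_def by (rule Sup_upper)
  \<comment> \<open>This is \<open>q\<close> with numerator and denominator divided by
    \<open>Suc s\<close>.\<close>
  have "(\<lambda>s. real c * real d / (real n + 1 + inverse (real (Suc s))))
      \<longlonglongrightarrow> real c * real d / (real n + 1 + 0)"
    by (intro tendsto_intros LIMSEQ_inverse_real_of_nat) auto
  moreover have "q = (\<lambda>s. real c * real d / (real n + 1 + inverse (real (Suc s))))"
  proof
    fix s
    have "q s = (real c * real d * real (Suc s)) /
        ((real n + 1 + inverse (real (Suc s))) * real (Suc s))"
      unfolding q_def by (simp add: distrib_right del: of_nat_Suc) (simp add: algebra_simps)
    then show "q s = real c * real d / (real n + 1 + inverse (real (Suc s)))"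
      by (simp del: of_nat_Suc)
  qed
  ultimately have "q \<longlonglongrightarrow> real c * (real n - real c + 2) / (real n + 1)"
    unfolding d by (simp only: add_0_right)
  then have "(\<lambda>s. ereal (q s)) \<longlonglongrightarrow> ereal (real c * (real n - real c + 2) / (real n + 1))"
    by simp
  then show "ereal (real c * (real n - real c + 2) / (real n + 1)) \<le> resurgence n ?I"
    by (rule LIMSEQ_le_const2) (use le in blast)
qed

end
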